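(* Let $w_{\min},w_{\max},c_{\min},c_{\max},v_{\min}$ be given real bounds and let $$\Omega=\{\mathbf U=(\rho,y,z)^\top\in\mathbb{R}^3:\ \rho>0,\ z>0,\ w(\mathbf U)\in[w_{\min},w_{\max}],\ c(\mathbf U)\in[c_{\min},c_{\max}],\ v(\mathbf U)\ge v_{\min}\}.$$ If $\hat{\mathbf U}=(\hat\rho,\hat y,\hat z)^\top\in\Omega$ and $\check{\mathbf U}=(\check\rho,\check y,\check z)^\top\in\Omega$, then $$\frac12\Big[\hat{\mathbf U}+\frac{\mathbf F(\hat{\mathbf U})}{\alpha}+\check{\mathbf U}-\frac{\mathbf F(\check{\mathbf U})}{\alpha}\Big]\in\Omega$$ under the condition $\alpha>\alpha_{\max}(\hat{\mathbf U},\check{\mathbf U})$.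
   Context: Fix parameters $\gamma\ge 0$, $\kappa\ge\gamma+1$, and a reference velocity $v_{\rm ref}>0$. For $\rho>0$, $z>0$ the pressure is $p(\rho,z)=\frac{v_{\rm ref}}{\gamma}z^{\kappa}\rho^{\gamma-\kappa}$ if $\gamma>0$, and $p(\rho,z)=v_{\rm ref}\log\rho$ if $\gamma=0$; subscripts on $p$ denote partial derivatives. For $\mathbf U=(\rho,y,z)^\top$ with $\rho,z>0$: $w(\mathbf U)=y/\rho$, $c(\mathbf U)=z/\rho$, $v(\mathbf U)=w(\mathbf U)-p(\rho,z)$, and $\mathbf F(\mathbf U)=v(\mathbf U)\,\mathbf U$. Definition of $\alpha_{\max}$. Put $s(\rho,z)=\rho^2p_\rho(\rho,z)+\rho z\,p_z(\rho,z)$ and $\overline\alpha(\mathbf U)=v(\mathbf U)+|\rho p_\rho(\rho,z)+z p_z(\rho,z)|$. With $\hat v=v(\hat{\mathbf U})$, $\check v=v(\check{\mathbf U})$, let $\alpha_{\rm std}=\max\{\overline\alpha(\hat{\mathbf U}),\overline\alpha(\check{\mathbf U})\}$, $$\rho_1=\tfrac{\hat\rho+\check\rho}{2},\quad \rho_2=\rho_1+\tfrac{\hat\rho\hat v-\check\rho\check v}{2\alpha_{\rm std}},\quad z_1=\tfrac{\hat z+\check z}{2},\quad z_2=z_1+\tfrac{\hat z\hat v-\check z\check v}{2\alpha_{\rm std}},$$ $$\overline s(\hat{\mathbf U},\check{\mathbf U})=\max\{s(\rho,z):\ \rho\in[\min\{\rho_1,\rho_2\},\max\{\rho_1,\rho_2\}],\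 z\in[\min\{z_1,z_2\},\max\{z_1,z_2\}]\},$$ $$\alpha_{\max}(\hat{\mathbf U},\check{\mathbf U})=\max\big\{\alpha_{\rm std},\ |\hat v|+\overline s(\hat{\mathbf U},\check{\mathbf U})/\hat\rho,\ |\check v|+\overline s(\hat{\mathbf U},\check{\mathbf U})/\check\rho\big\}.$$
   Formalization: The formal theorem adds the hypothesis α_std > 0 (automatic when both velocities are nonnegative); for α_std = 0 the formulas divide by zero and for α_std < 0 the claim can fail. Where the rectangle leaves ρ,z>0, the maximum s̄ is a supremum over its part in that quadrant. *)

theory Defs
  imports "HOL-Analysis.Analysis"
begin

text \<open>A state \<open>U = (\<rho>, y, z)\<close> is a vector in \<open>real^3\<close>. Parameters are always listed in the order
  \<open>\<gamma>\<close>, \<open>\<kappa>\<close>, \<open>v\<^sub>r\<^sub>e\<^sub>f\<close>.\<close>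

definition press :: "real \<Rightarrow> real \<Rightarrow> real \<Rightarrow> real \<Rightarrow> real \<Rightarrow> real" where
  "press \<gamma> \<kappa> vref \<rho> z =
     (if \<gamma> = 0 then vref * ln \<rho> else vref / \<gamma> * z powr \<kappa> * \<rho> powr (\<gamma> - \<kappa>))"

definition press_rho :: "real \<Rightarrow> real \<Rightarrow> real \<Rightarrow> real \<Rightarrow> real \<Rightarrow> real" where
  "press_rho \<gamma> \<kappa> vref \<rho> z = deriv (\<lambda>r. press \<gamma> \<kappa> vref r z) \<rho>"

definition press_z :: "real \<Rightarrow> real \<Rightarrow> real \<Rightarrow> real \<Rightarrow> real \<Rightarrow> real" where
  "press_z \<gamma> \<kappa> vref \<rho> z = deriv (\<lambda>x. press \<gamma> \<kappa> vref \<rho> x) z"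

definition w_of :: "real^3 \<Rightarrow> real" where
  "w_of U = U $ 2 / U $ 1"

definition c_of :: "real^3 \<Rightarrow> real" where
  "c_of U = U $ 3 / U $ 1"

definition v_of :: "real \<Rightarrow> real \<Rightarrow> real \<Rightarrow> real^3 \<Rightarrow> real" where
  "v_of \<gamma> \<kappa> vref U = w_of U - press \<gamma> \<kappa> vref (U $ 1) (U $ 3)"

definition flux :: "real \<Rightarrow> real \<Rightarrow> real \<Rightarrow> real^3 \<Rightarrow> real^3" where
  "flux \<gamma> \<kappa> vref U = v_of \<gamma> \<kappa> vref U *\<^sub>R U"

definition s_of :: "real \<Rightarrow> real \<Rightarrow> real \<Rightarrow> real \<Rightarrow> real \<Rightarrow> real" where
  "s_of \<gamma> \<kappa> vref \<rho> z = \<rho>\<^sup>2 * press_rho \<gamma> \<kappa> vref \<rho> z + \<rho> * z * press_z \<gamma> \<kappa> vref \<rho> z"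

definition alpha_bar :: "real \<Rightarrow> real \<Rightarrow> real \<Rightarrow> real^3 \<Rightarrow> real" where
  "alpha_bar \<gamma> \<kappa> vref U = v_of \<gamma> \<kappa> vref U +
     \<bar>U $ 1 * press_rho \<gamma> \<kappa> vref (U $ 1) (U $ 3) + U $ 3 * press_z \<gamma> \<kappa> vref (U $ 1) (U $ 3)\<bar>"

definition alpha_std :: "real \<Rightarrow> real \<Rightarrow> real \<Rightarrow> real^3 \<Rightarrow> real^3 \<Rightarrow> real" where
  "alpha_std \<gamma> \<kappa> vref Uh Uc = max (alpha_bar \<gamma> \<kappa> vref Uh) (alpha_bar \<gamma> \<kappa> vref Uc)"

definition rho1 :: "real^3 \<Rightarrow> real^3 \<Rightarrow> real" where
  "rho1 Uh Uc = (Uh $ 1 + Uc $ 1) / 2"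

definition rho2 :: "real \<Rightarrow> real \<Rightarrow> real \<Rightarrow> real^3 \<Rightarrow> real^3 \<Rightarrow> real" where
  "rho2 \<gamma> \<kappa> vref Uh Uc = rho1 Uh Uc +
     (Uh $ 1 * v_of \<gamma> \<kappa> vref Uh - Uc $ 1 * v_of \<gamma> \<kappa> vref Uc) / (2 * alpha_std \<gamma> \<kappa> vref Uh Uc)"

definition z1 :: "real^3 \<Rightarrow> real^3 \<Rightarrow> real" where
  "z1 Uh Uc = (Uh $ 3 + Uc $ 3) / 2"

definition z2 :: "real \<Rightarrow> real \<Rightarrow> real \<Rightarrow> real^3 \<Rightarrow> real^3 \<Rightarrow> real" where
  "z2 \<gamma> \<kappa> vref Uh Uc = z1 Uh Uc +
     (Uh $ 3 * v_of \<gamma> \<kappa> vref Uh - Uc $ 3 * v_of \<gamma> \<kappa> vref Uc) / (2 * alpha_std \<gamma> \<kappa> vref Uh Uc)"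

definition rect :: "real \<Rightarrow> real \<Rightarrow> real \<Rightarrow> real^3 \<Rightarrow> real^3 \<Rightarrow> (real \<times> real) set" where
  "rect \<gamma> \<kappa> vref Uh Uc =
     {min (rho1 Uh Uc) (rho2 \<gamma> \<kappa> vref Uh Uc)..max (rho1 Uh Uc) (rho2 \<gamma> \<kappa> vref Uh Uc)} \<times>
     {min (z1 Uh Uc) (z2 \<gamma> \<kappa> vref Uh Uc)..max (z1 Uh Uc) (z2 \<gamma> \<kappa> vref Uh Uc)}"

text \<open>The pressure, hence \<open>s\<close>, is only given for \<open>\<rho>, z > 0\<close>. For negative velocities the rectangle can
  leave this quadrant, and then \<open>s\<close> need not have a maximum on it. The supremum is therefore taken
  in the extended reals over the part of the rectangle inside the quadrant; if the whole rectangle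
  lies in the quadrant it is the maximum of \<open>s\<close> (lemma \<open>s_bar_is_max\<close>), and if \<open>s\<close> is unbounded
  it is infinite, so that no real \<open>\<alpha>\<close> exceeds \<open>alpha_max\<close>.\<close>

definition s_bar :: "real \<Rightarrow> real \<Rightarrow> real \<Rightarrow> real^3 \<Rightarrow> real^3 \<Rightarrow> ereal" where
  "s_bar \<gamma> \<kappa> vref Uh Uc =
     (SUP (\<rho>, z) \<in> rect \<gamma> \<kappa> vref Uh Uc \<inter> {0<..} \<times> {0<..}. ereal (s_of \<gamma> \<kappa> vref \<rho> z))"

definition alpha_max :: "real \<Rightarrow> real \<Rightarrow> real \<Rightarrow> real^3 \<Rightarrow> real^3 \<Rightarrow> ereal" where
  "alpha_max \<gamma> \<kappa> vref Uh Uc =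
     Max {ereal (alpha_std \<gamma> \<kappa> vref Uh Uc),
          ereal \<bar>v_of \<gamma> \<kappa> vref Uh\<bar> + s_bar \<gamma> \<kappa> vref Uh Uc / ereal (Uh $ 1),
          ereal \<bar>v_of \<gamma> \<kappa> vref Uc\<bar> + s_bar \<gamma> \<kappa> vref Uh Uc / ereal (Uc $ 1)}"

definition Omega :: "real \<Rightarrow> real \<Rightarrow> real \<Rightarrow> real \<Rightarrow> real \<Rightarrow> real \<Rightarrow> real \<Rightarrow> real \<Rightarrow> (real^3) set" where
  "Omega \<gamma> \<kappa> vref wmin wmax cmin cmax vmin =
     {U. U $ 1 > 0 \<and> U $ 3 > 0 \<and> w_of U \<in> {wmin..wmax} \<and> c_of U \<in> {cmin..cmax} \<and>
         v_of \<gamma> \<kappa> vref U \<ge> vmin}"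

lemma press_rho_eq:
  assumes "\<rho> > 0" "z > 0"
  shows "press_rho \<gamma> \<kappa> vref \<rho> z =
    (if \<gamma> = 0 then vref / \<rho> else vref / \<gamma> * z powr \<kappa> * ((\<gamma> - \<kappa>) * \<rho> powr (\<gamma> - \<kappa> - 1)))"
  unfolding press_rho_def press_def using assms
  by (auto intro!: DERIV_imp_deriv derivative_eq_intros)

lemma press_z_eq:
  assumes "\<rho> > 0" "z > 0"
  shows "press_z \<gamma> \<kappa> vref \<rho> z =
    (if \<gamma> = 0 then 0 else vref / \<gamma> * (\<kappa> * z powr (\<kappa> - 1)) * \<rho> powr (\<gamma> - \<kappa>))"
  unfolding press_z_def press_def using assms
  by (auto intro!: DERIV_imp_deriv derivative_eq_intros)

lemma char_speed_eq:
  assumes "\<rho> > 0" "z > 0"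
  shows "\<rho> * press_rho \<gamma> \<kappa> vref \<rho> z + z * press_z \<gamma> \<kappa> vref \<rho> z =
    (if \<gamma> = 0 then vref else vref * z powr \<kappa> * \<rho> powr (\<gamma> - \<kappa>))"
proof (cases "\<gamma> = 0")
  case False
  have "\<rho> powr (\<gamma> - \<kappa> - 1) = \<rho> powr (\<gamma> - \<kappa>) / \<rho>" "z powr (\<kappa> - 1) = z powr \<kappa> / z"
    using assms powr_diff[of \<rho> "\<gamma> - \<kappa>" 1] powr_diff[of z \<kappa> 1] by simp_all
  then have "\<rho> * press_rho \<gamma> \<kappa> vref \<rho> z + z * press_z \<gamma> \<kappa> vref \<rho> z =
     vref / \<gamma> * z powr \<kappa> * (\<gamma> - \<kappa>) * \<rho> powr (\<gamma> - \<kappa>) + vref / \<gamma> * \<kappa> * z powr \<kappa> * \<rho> powr (\<gamma> - \<kappa>)"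
    using False assms by (simp add: press_rho_eq press_z_eq)
  also have "\<dots> = vref * z powr \<kappa> * \<rho> powr (\<gamma> - \<kappa>)"
    using False by (simp add: field_simps)
  finally show ?thesis using False by simp
qed (use assms in \<open>simp add: press_rho_eq press_z_eq\<close>)

lemma s_of_eq:
  assumes "\<rho> > 0" "z > 0"
  shows "s_of \<gamma> \<kappa> vref \<rho> z =
    \<rho> * (if \<gamma> = 0 then vref else vref * z powr \<kappa> * \<rho> powr (\<gamma> - \<kappa>))"
  unfolding char_speed_eq[OF assms, symmetric] s_of_def
  by (simp add: power2_eq_square algebra_simps)

lemma s_bar_is_max:
  assumes "Uh $ 1 > 0" "Uh $ 3 > 0" "Uc $ 1 > 0" "Uc $ 3 > 0"
    and "rho2 \<gamma> \<kappa> vref Uh Uc > 0" "z2 \<gamma> \<kappa> vref Uh Uc > 0"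
  shows "\<exists>(\<rho>, z) \<in> rect \<gamma> \<kappa> vref Uh Uc. s_bar \<gamma> \<kappa> vref Uh Uc = ereal (s_of \<gamma> \<kappa> vref \<rho> z) \<and>
           (\<forall>(\<rho>', z') \<in> rect \<gamma> \<kappa> vref Uh Uc. s_of \<gamma> \<kappa> vref \<rho>' z' \<le> s_of \<gamma> \<kappa> vref \<rho> z)"
proof -
  let ?R = "rect \<gamma> \<kappa> vref Uh Uc" and ?s = "\<lambda>(\<rho>, z). s_of \<gamma> \<kappa> vref \<rho> z"
  have pos: "\<rho> > 0 \<and> z > 0" if "(\<rho>, z) \<in> ?R" for \<rho> z
    using that assms unfolding rect_def rho1_def z1_def by (auto simp: min_def split: if_splits)
  have "continuous_on ?R
      (\<lambda>x. fst x * (if \<gamma> = 0 then vref else vref * snd x powr \<kappa> * fst x powr (\<gamma> - \<kappa>)))"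
    using pos by (cases "\<gamma> = 0") (fastforce intro!: continuous_intros)+
  then have "continuous_on ?R ?s"
    by (rule continuous_on_eq) (use pos in \<open>auto simp: s_of_eq\<close>)
  moreover have "compact ?R" "?R \<noteq> {}"
    unfolding rect_def by (auto intro!: compact_Times)
  ultimately obtain x where x: "x \<in> ?R" "\<forall>y\<in>?R. ?s y \<le> ?s x"
    using continuous_attains_sup by blast
  have "?R \<inter> {0<..} \<times> {0<..} = ?R" using pos by auto
  then have "s_bar \<gamma> \<kappa> vref Uh Uc = (SUP y\<in>?R. ereal (?s y))"
    unfolding s_bar_def by (simp add: case_prod_unfold)
  also have "\<dots> = ereal (?s x)"
    using x by (intro antisym SUP_least SUP_upper) auto
  finally show ?thesis using x by (intro bexI[of _ x]) (auto split: prod.splits)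
qed

lemma well_defined_if_nonneg_velocity:
  assumes "vref > 0" "Uh $ 1 > 0" "Uh $ 3 > 0" "Uc $ 1 > 0" "Uc $ 3 > 0"
    and vh: "v_of \<gamma> \<kappa> vref Uh \<ge> 0" and vc: "v_of \<gamma> \<kappa> vref Uc \<ge> 0"
  shows "alpha_std \<gamma> \<kappa> vref Uh Uc > 0" "rho2 \<gamma> \<kappa> vref Uh Uc > 0" "z2 \<gamma> \<kappa> vref Uh Uc > 0"
proof -
  have gt: "v_of \<gamma> \<kappa> vref Uh < alpha_bar \<gamma> \<kappa> vref Uh" "v_of \<gamma> \<kappa> vref Uc < alpha_bar \<gamma> \<kappa> vref Uc"
    unfolding alpha_bar_def using assms by (simp_all add: char_speed_eq)
  let ?a = "alpha_std \<gamma> \<kappa> vref Uh Uc"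
  show a: "?a > 0" using gt vh unfolding alpha_std_def by linarith
  have lt: "v_of \<gamma> \<kappa> vref Uc / ?a < 1"
    using gt(2) a unfolding alpha_std_def by (subst divide_less_eq_1_pos) auto
  have *: "(x + y) / 2 + (x * v_of \<gamma> \<kappa> vref Uh - y * v_of \<gamma> \<kappa> vref Uc) / (2 * ?a) > 0"
    if "x > 0" "y > 0" for x y
  proof -
    have "(x + y) / 2 + (x * v_of \<gamma> \<kappa> vref Uh - y * v_of \<gamma> \<kappa> vref Uc) / (2 * ?a) =
        (x * (1 + v_of \<gamma> \<kappa> vref Uh / ?a) + y * (1 - v_of \<gamma> \<kappa> vref Uc / ?a)) / 2"
      using a by (simp add: field_simps)
    also have "\<dots> > 0"
      using that lt a vh by (simp add: add_pos_pos add_pos_nonneg)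
    finally show ?thesis .
  qed
  show "rho2 \<gamma> \<kappa> vref Uh Uc > 0" "z2 \<gamma> \<kappa> vref Uh Uc > 0"
    unfolding rho2_def rho1_def z2_def z1_def using * assms by auto
qed

end

theory Submission
  imports Defs
begin

text \<open>
  The new state is \<open>U = \<lambda>\<^sub>h U\<^sub>h + \<lambda>\<^sub>c U\<^sub>c\<close> with \<open>2\<alpha>\<lambda>\<^sub>h = \<alpha> + v\<^sub>h\<close> and \<open>2\<alpha>\<lambda>\<^sub>c = \<alpha> - v\<^sub>c\<close>, both positive, so
  \<open>w(U)\<close> and \<open>c(U)\<close> are averages of the old values. The total weight \<open>t = 1 + (v\<^sub>h - v\<^sub>c)/(2\<alpha>)\<close> is not
  1. Since \<open>\<rho> p\<close> is convex, Jensen's inequality bounds \<open>\<rho> p(U/t)\<close> by \<open>\<lambda>\<^sub>h \<rho>\<^sub>h p\<^sub>h + \<lambda>\<^sub>c \<rho>\<^sub>c p\<^sub>c\<close>, while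
  homogeneity of \<open>p\<close> gives \<open>\<rho> (p(U) - p(U/t)) \<le> s(U) ln t \<le> s(U) (t - 1)\<close>. Together,
  \<open>\<rho> (v(U) - v\<^sub>m\<^sub>i\<^sub>n) \<ge> (\<lambda>\<^sub>h \<rho>\<^sub>h - s(U)/(2\<alpha>)) (v\<^sub>h - v\<^sub>m\<^sub>i\<^sub>n) + (\<lambda>\<^sub>c \<rho>\<^sub>c + s(U)/(2\<alpha>)) (v\<^sub>c - v\<^sub>m\<^sub>i\<^sub>n)\<close>,
  and the bound on \<open>\<alpha>\<close> makes both coefficients nonnegative.
\<close>

section \<open>Convexity of \<rho> p\<close>

text \<open>The tangent of x ln x at y, rearranged; it follows from ln u \<le> u - 1 at u = y /
  x.\<close>

lemma le_self_times_one_plus_ln: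
  fixes x y :: real
  assumes "x > 0" "y > 0"
  shows "x * (1 + ln y - ln x) \<le> y"
proof -
  have "ln (y / x) \<le> y / x - 1"
    using assms by (intro ln_le_minus_one) simp
  then have "x * (1 + (ln y - ln x)) \<le> x * (y / x)"
    using assms by (intro mult_left_mono) (simp_all add: ln_div)
  then show ?thesis using assms by (simp add: algebra_simps)
qed

text \<open>Weighted AM-GM for \<open>x = (x\<^sup>\<kappa> y\<^sup>-\<^sup>m)\<^bsup>1/\<kappa>\<^esup> y\<^bsup>m/\<kappa>\<^esup> 1\<^bsup>\<gamma>/\<kappa>\<^esup>\<close>, where \<open>\<kappa> = m + \<gamma> + 1\<close>.\<close>

lemma powr_mult_powr_tangent:
  fixes x y \<gamma> m \<kappa> :: real
  assumes "x > 0" "y > 0" "\<gamma> \<ge> 0" "m \<ge> 0" "\<kappa> = m + \<gamma> + 1"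
  shows "1 + \<kappa> * (x - 1) - m * (y - 1) \<le> x powr \<kappa> * y powr (- m)"
proof -
  define Q where "Q = x powr \<kappa> * y powr (- m)"
  have Q: "Q > 0" "ln Q = \<kappa> * ln x - m * ln y"
    using assms unfolding Q_def by (simp_all add: ln_mult ln_powr)
  \<comment> \<open>The weights 1, m, \<gamma> of the next three bounds sum to \<kappa>, and all
    logarithms cancel in their sum.\<close>
  have "x * (1 + ln Q - ln x) \<le> Q"
    using assms Q by (intro le_self_times_one_plus_ln)
  moreover have "m * (x * (1 + ln y - ln x)) \<le> m * y"
    using assms by (intro mult_left_mono le_self_times_one_plus_ln)
  moreover have "\<gamma> * (x * (1 + ln 1 - ln x)) \<le> \<gamma> * 1"
    using assms by (intro mult_left_mono le_self_times_one_plus_ln) auto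
  moreover have "x * (1 + ln Q - ln x) + m * (x * (1 + ln y - ln x)) + \<gamma> * (x * (1 + ln 1 - ln x))
      = \<kappa> * x"
    unfolding Q(2) assms(5) by (simp add: algebra_simps)
  ultimately have "\<kappa> * x \<le> Q + m * y + \<gamma>" by linarith
  then show ?thesis
    using assms(5) unfolding Q_def by (simp add: algebra_simps)
qed

text \<open>For \<gamma> = 0 this is the tangent of \<rho> ln \<rho>; otherwise \<rho> p is a
  multiple of z^\<kappa> \<rho>^(-m) with m \<ge> 0, and rescaling by the base point reduces to
  \<open>powr_mult_powr_tangent\<close>. The slopes form the gradient of \<rho> p.\<close>

lemma rho_press_supporting_plane:
  assumes "\<gamma> \<ge> 0" "\<kappa> \<ge> \<gamma> + 1" "vref > 0" "\<rho>0 > 0" "z0 > 0"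
  shows "\<exists>A B. \<forall>\<rho>>0. \<forall>z>0.
    \<rho>0 * press \<gamma> \<kappa> vref \<rho>0 z0 + A * (\<rho> - \<rho>0) + B * (z - z0) \<le> \<rho> * press \<gamma> \<kappa> vref \<rho> z"
proof (cases "\<gamma> = 0")
  case True
  have "\<rho>0 * press \<gamma> \<kappa> vref \<rho>0 z0 + vref * (1 + ln \<rho>0) * (\<rho> - \<rho>0) + 0 * (z - z0)
      \<le> \<rho> * press \<gamma> \<kappa> vref \<rho> z" if "\<rho> > 0" for \<rho> z
  proof -
    have "vref * (\<rho> * (1 + ln \<rho>0 - ln \<rho>)) \<le> vref * \<rho>0"
      using assms that by (intro mult_left_mono le_self_times_one_plus_ln) auto
    then show ?thesis
      using True by (simp add: press_def algebra_simps)
  qed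
  then show ?thesis by blast
next
  case False
  define m where "m = \<kappa> - \<gamma> - 1"
  define Q where "Q = \<rho>0 * press \<gamma> \<kappa> vref \<rho>0 z0"
  have Qpos: "Q > 0"
    using assms False unfolding Q_def by (simp add: press_def)
  have "Q + (- Q * m / \<rho>0) * (\<rho> - \<rho>0) + (Q * \<kappa> / z0) * (z - z0) \<le> \<rho> * press \<gamma> \<kappa> vref \<rho> z"
    if "\<rho> > 0" "z > 0" for \<rho> z
  proof -
    have "1 + \<kappa> * (z / z0 - 1) - m * (\<rho> / \<rho>0 - 1) \<le> (z / z0) powr \<kappa> * (\<rho> / \<rho>0) powr (- m)"
      using assms that unfolding m_def by (intro powr_mult_powr_tangent[of _ _ \<gamma>]) auto
    then have "Q * (1 + \<kappa> * (z / z0 - 1) - m * (\<rho> / \<rho>0 - 1))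
        \<le> Q * ((z / z0) powr \<kappa> * (\<rho> / \<rho>0) powr (- m))"
      using Qpos by (intro mult_left_mono) auto
    also have "\<dots> = \<rho> * press \<gamma> \<kappa> vref \<rho> z"
    proof -
      have e: "r * r powr (\<gamma> - \<kappa>) = r powr (- m)" if "r > 0" for r :: real
        using powr_add[of r 1 "\<gamma> - \<kappa>"] that unfolding m_def by (simp add: algebra_simps)
      have q: "r * press \<gamma> \<kappa> vref r x = vref / \<gamma> * x powr \<kappa> * r powr (- m)" if "r > 0" for r x
        unfolding e[OF that, symmetric] using False by (simp add: press_def)
      show ?thesis
        unfolding Q_def q[OF \<open>\<rho>0 > 0\<close>] q[OF \<open>\<rho> > 0\<close>]
        using assms that by (simp add: powr_divide)
    qed
    finally show ?thesis
      using assms by (simp add: field_simps)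
  qed
  then show ?thesis unfolding Q_def by blast
qed

text \<open>The plane is taken at the normalized mean, where the linear terms cancel. The weights
  need not sum to 1, hence the division by a + b.\<close>

lemma rho_press_jensen:
  fixes a b :: real
  assumes "\<gamma> \<ge> 0" "\<kappa> \<ge> \<gamma> + 1" "vref > 0"
    and pos: "\<rho>h > 0" "zh > 0" "\<rho>c > 0" "zc > 0" "a > 0" "b > 0"
    and \<rho>: "\<rho> = a * \<rho>h + b * \<rho>c" and z: "z = a * zh + b * zc"
  shows "\<rho> * press \<gamma> \<kappa> vref (\<rho> / (a + b)) (z / (a + b))
    \<le> a * (\<rho>h * press \<gamma> \<kappa> vref \<rho>h zh) + b * (\<rho>c * press \<gamma> \<kappa> vref \<rho>c zc)"
proof -
  define t r x where "t = a + b" and "r = \<rho> / t" and "x = z / t"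
  have t: "t > 0" "t * r = \<rho>" "t * x = z"
    using pos unfolding t_def r_def x_def by simp_all
  have "r > 0" "x > 0"
    using pos t(1) unfolding r_def x_def \<rho> z by (simp_all add: add_pos_pos)
  then obtain A B where AB: "\<And>\<rho> z. \<rho> > 0 \<Longrightarrow> z > 0 \<Longrightarrow>
      r * press \<gamma> \<kappa> vref r x + A * (\<rho> - r) + B * (z - x) \<le> \<rho> * press \<gamma> \<kappa> vref \<rho> z"
    using rho_press_supporting_plane[OF assms(1-3)] by meson
  let ?P = "r * press \<gamma> \<kappa> vref r x"
  have "a * (?P + A * (\<rho>h - r) + B * (zh - x)) + b * (?P + A * (\<rho>c - r) + B * (zc - x))
      \<le> a * (\<rho>h * press \<gamma> \<kappa> vref \<rho>h zh) + b * (\<rho>c * press \<gamma> \<kappa> vref \<rho>c zc)"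
    using pos by (intro add_mono mult_left_mono AB) auto
  moreover have "a * (?P + A * (\<rho>h - r) + B * (zh - x)) + b * (?P + A * (\<rho>c - r) + B * (zc - x))
      = t * ?P + A * (\<rho> - t * r) + B * (z - t * x)"
    unfolding \<rho> z t_def by (simp add: algebra_simps)
  moreover have "t * ?P = \<rho> * press \<gamma> \<kappa> vref r x"
    using t(2) by (simp add: mult.assoc[symmetric])
  ultimately show ?thesis
    using t unfolding r_def x_def t_def by simp
qed

section \<open>Pressure along rays through the origin\<close>

lemma s_of_pos:
  assumes "vref > 0" "\<rho> > 0" "z > 0"
  shows "s_of \<gamma> \<kappa> vref \<rho> z > 0"
  using assms by (simp add: s_of_eq)

text \<open>Dividing both arguments by t multiplies p by t^(-\<gamma>), or subtracts
  \<open>vref * ln t\<close> if \<gamma> = 0. For \<gamma> > 0, s = \<gamma> \<rho> p, so the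
  exponential's tangent 1 - t^(-\<gamma>) \<le> \<gamma> ln t produces the factor s.\<close>

lemma rho_press_scaling:
  assumes "\<gamma> \<ge> 0" "vref > 0" "\<rho> > 0" "z > 0" "t > 0"
  shows "\<rho> * (press \<gamma> \<kappa> vref \<rho> z - press \<gamma> \<kappa> vref (\<rho> / t) (z / t))
    \<le> s_of \<gamma> \<kappa> vref \<rho> z * (t - 1)"
proof -
  have "\<rho> * (press \<gamma> \<kappa> vref \<rho> z - press \<gamma> \<kappa> vref (\<rho> / t) (z / t)) \<le> s_of \<gamma> \<kappa> vref \<rho> z * ln t"
  proof (cases "\<gamma> = 0")
    case True
    then show ?thesis
      using assms by (simp add: press_def s_of_eq ln_div algebra_simps)
  next
    case False
    define S where "S = z powr \<kappa> * \<rho> powr (\<gamma> - \<kappa>)"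
    have "t powr \<kappa> * t powr (\<gamma> - \<kappa>) = t powr \<gamma>"
      by (simp add: powr_add[symmetric])
    then have "press \<gamma> \<kappa> vref (\<rho> / t) (z / t) = vref / \<gamma> * (S / t powr \<gamma>)"
      using False assms unfolding S_def by (simp add: press_def powr_divide mult.assoc)
    also have "\<dots> = vref / \<gamma> * S * t powr (- \<gamma>)"
      by (simp add: powr_minus divide_inverse)
    finally have "press \<gamma> \<kappa> vref (\<rho> / t) (z / t) = vref / \<gamma> * S * t powr (- \<gamma>)" .
    moreover have "press \<gamma> \<kappa> vref \<rho> z = vref / \<gamma> * S"
      using False unfolding S_def by (simp add: press_def)
    ultimately have eq: "\<rho> * (press \<gamma> \<kappa> vref \<rho> z - press \<gamma> \<kappa> vref (\<rho> / t) (z / t))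
        = \<rho> * (vref / \<gamma> * S) * (1 - t powr (- \<gamma>))"
      by (simp only: right_diff_distrib mult_1_right mult.assoc)
    have "1 + (- \<gamma> * ln t) \<le> t powr (- \<gamma>)"
      using assms exp_ge_add_one_self[of "- \<gamma> * ln t"] by (simp add: powr_def)
    then have "\<rho> * (vref / \<gamma> * S) * (1 - t powr (- \<gamma>)) \<le> \<rho> * (vref / \<gamma> * S) * (\<gamma> * ln t)"
      using assms by (intro mult_left_mono) (auto simp: S_def)
    also have "\<dots> = s_of \<gamma> \<kappa> vref \<rho> z * ln t"
      using False assms unfolding S_def by (simp add: s_of_eq)
    finally show ?thesis unfolding eq .
  qed
  also have "\<dots> \<le> s_of \<gamma> \<kappa> vref \<rho> z * (t - 1)"
    using assms s_of_pos[of vref \<rho> z \<gamma> \<kappa>] by (intro mult_left_mono ln_le_minus_one) auto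
  finally show ?thesis .
qed

section \<open>What the bound on \<alpha> provides\<close>

text \<open>A larger denominator only pulls the point back towards x. So a rectangle built with
  \<open>alpha_std\<close> serves every larger \<alpha>.\<close>

lemma between_add_divide:
  fixes x d a b :: real
  assumes "0 < a" "a \<le> b"
  shows "x + d / (2 * b) \<in> {min x (x + d / (2 * a))..max x (x + d / (2 * a))}"
proof (cases "d \<ge> 0")
  case True
  then have "0 \<le> d / (2 * b)" "d / (2 * b) \<le> d / (2 * a)"
    using assms by (auto intro!: divide_left_mono mult_pos_pos)
  then show ?thesis by auto
next
  case False
  then have "d / (2 * b) \<le> 0" "d / (2 * a) \<le> d / (2 * b)"
    using assms by (auto intro!: divide_left_mono_neg divide_nonpos_pos simp: mult_pos_pos)
  then show ?thesis by auto
qed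

lemma add_divide_in_rect:
  assumes "alpha_std \<gamma> \<kappa> vref Uh Uc > 0" "alpha_std \<gamma> \<kappa> vref Uh Uc \<le> \<alpha>"
  shows "(rho1 Uh Uc + (Uh $ 1 * v_of \<gamma> \<kappa> vref Uh - Uc $ 1 * v_of \<gamma> \<kappa> vref Uc) / (2 * \<alpha>),
          z1 Uh Uc + (Uh $ 3 * v_of \<gamma> \<kappa> vref Uh - Uc $ 3 * v_of \<gamma> \<kappa> vref Uc) / (2 * \<alpha>))
         \<in> rect \<gamma> \<kappa> vref Uh Uc"
  unfolding rect_def rho2_def z2_def using assms by (intro SigmaI between_add_divide)

lemma s_of_le_s_bar:
  assumes "(\<rho>, z) \<in> rect \<gamma> \<kappa> vref Uh Uc" "\<rho> > 0" "z > 0"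
  shows "ereal (s_of \<gamma> \<kappa> vref \<rho> z) \<le> s_bar \<gamma> \<kappa> vref Uh Uc"
  unfolding s_bar_def by (rule SUP_upper2[of "(\<rho>, z)"]) (use assms in auto)

text \<open>Returns from extended to real numbers: the possibly infinite \<open>s_bar\<close> is
  replaced by any real s below it.\<close>

lemma alpha_max_less:
  assumes "ereal \<alpha> > alpha_max \<gamma> \<kappa> vref Uh Uc" "Uh $ 1 > 0" "Uc $ 1 > 0"
    and s: "ereal s \<le> s_bar \<gamma> \<kappa> vref Uh Uc"
  shows "alpha_std \<gamma> \<kappa> vref Uh Uc < \<alpha>"
    and "\<bar>v_of \<gamma> \<kappa> vref Uh\<bar> + s / Uh $ 1 < \<alpha>"
    and "\<bar>v_of \<gamma> \<kappa> vref Uc\<bar> + s / Uc $ 1 < \<alpha>"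
proof -
  have lt: "ereal (alpha_std \<gamma> \<kappa> vref Uh Uc) < ereal \<alpha>"
    "ereal \<bar>v_of \<gamma> \<kappa> vref Uh\<bar> + s_bar \<gamma> \<kappa> vref Uh Uc / ereal (Uh $ 1) < ereal \<alpha>"
    "ereal \<bar>v_of \<gamma> \<kappa> vref Uc\<bar> + s_bar \<gamma> \<kappa> vref Uh Uc / ereal (Uc $ 1) < ereal \<alpha>"
    using assms(1) unfolding alpha_max_def by auto
  have *: "v + s / r < \<alpha>"
    if "ereal v + s_bar \<gamma> \<kappa> vref Uh Uc / ereal r < ereal \<alpha>" "r > 0" for v r
  proof -
    have "ereal s / ereal r \<le> s_bar \<gamma> \<kappa> vref Uh Uc / ereal r"
      using s that by (intro ereal_divide_right_mono) auto
    then have "ereal v + ereal s / ereal r < ereal \<alpha>"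
      using that(1) by (meson add_left_mono le_less_trans)
    then show ?thesis using that(2) by simp
  qed
  show "alpha_std \<gamma> \<kappa> vref Uh Uc < \<alpha>" using lt(1) by simp
  show "\<bar>v_of \<gamma> \<kappa> vref Uh\<bar> + s / Uh $ 1 < \<alpha>" "\<bar>v_of \<gamma> \<kappa> vref Uc\<bar> + s / Uc $ 1 < \<alpha>"
    using * lt(2,3) assms(2,3) by blast+
qed

section \<open>Invariance of the domain\<close>

lemma mediant_in_interval:
  fixes a b r1 r2 y1 y2 l u :: real
  assumes "a > 0" "b > 0" "r1 > 0" "r2 > 0" "y1 / r1 \<in> {l..u}" "y2 / r2 \<in> {l..u}"
  shows "(a * y1 + b * y2) / (a * r1 + b * r2) \<in> {l..u}"
proof -
  have "l * r1 \<le> y1" "y1 \<le> u * r1" "l * r2 \<le> y2" "y2 \<le> u * r2"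
    using assms by (auto simp: field_simps)
  then have "a * (l * r1) + b * (l * r2) \<le> a * y1 + b * y2"
    "a * y1 + b * y2 \<le> a * (u * r1) + b * (u * r2)"
    using assms by (auto intro!: add_mono mult_left_mono)
  moreover have "a * r1 + b * r2 > 0" using assms by (simp add: add_pos_pos)
  ultimately show ?thesis by (auto simp: field_simps)
qed

theorem theorem2p6:
  fixes \<gamma> \<kappa> vref wmin wmax cmin cmax vmin \<alpha> :: real
    and Uh Uc :: "real^3"
  assumes "\<gamma> \<ge> 0" and "\<kappa> \<ge> \<gamma> + 1" and "vref > 0"
    and "Uh \<in> Omega \<gamma> \<kappa> vref wmin wmax cmin cmax vmin"
    and "Uc \<in> Omega \<gamma> \<kappa> vref wmin wmax cmin cmax vmin"
    and "alpha_std \<gamma> \<kappa> vref Uh Uc > 0"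
    and "ereal \<alpha> > alpha_max \<gamma> \<kappa> vref Uh Uc"
  shows "(1 / 2) *\<^sub>R (Uh + flux \<gamma> \<kappa> vref Uh /\<^sub>R \<alpha> + Uc - flux \<gamma> \<kappa> vref Uc /\<^sub>R \<alpha>)
           \<in> Omega \<gamma> \<kappa> vref wmin wmax cmin cmax vmin"
proof -
  define U where "U = (1 / 2) *\<^sub>R (Uh + flux \<gamma> \<kappa> vref Uh /\<^sub>R \<alpha> + Uc - flux \<gamma> \<kappa> vref Uc /\<^sub>R \<alpha>)"
  define vh vc where "vh = v_of \<gamma> \<kappa> vref Uh" and "vc = v_of \<gamma> \<kappa> vref Uc"
  \<comment> \<open>The flux is a scalar multiple of the state, so the new state is a combination of
    the old ones with these weights.\<close>
  define a b where "a = (1 + vh / \<alpha>) / 2" and "b = (1 - vc / \<alpha>) / 2"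
  let ?p = "press \<gamma> \<kappa> vref"
  have h: "Uh $ 1 > 0" "Uh $ 3 > 0" "w_of Uh \<in> {wmin..wmax}" "c_of Uh \<in> {cmin..cmax}" "vh \<ge> vmin"
    and c: "Uc $ 1 > 0" "Uc $ 3 > 0" "w_of Uc \<in> {wmin..wmax}" "c_of Uc \<in> {cmin..cmax}" "vc \<ge> vmin"
    using assms(4,5) unfolding Omega_def vh_def vc_def by auto
  have U: "U $ i = a * Uh $ i + b * Uc $ i" for i
    unfolding U_def a_def b_def vh_def vc_def flux_def by (simp add: field_simps)

  \<comment> \<open>Positivity of the weights must precede that of \<open>U\<close>. The corner
    (\<open>rho1\<close>, \<open>z1\<close>) already shows \<open>s_bar\<close> \<ge> 0, whence both
    velocities are below \<alpha> in modulus.\<close>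
  have "(rho1 Uh Uc, z1 Uh Uc) \<in> rect \<gamma> \<kappa> vref Uh Uc"
    unfolding rect_def by auto
  moreover have \<rho>1z1: "rho1 Uh Uc > 0" "z1 Uh Uc > 0"
    using h c unfolding rho1_def z1_def by simp_all
  ultimately have "ereal (s_of \<gamma> \<kappa> vref (rho1 Uh Uc) (z1 Uh Uc)) \<le> s_bar \<gamma> \<kappa> vref Uh Uc"
    by (rule s_of_le_s_bar)
  then have "ereal 0 \<le> s_bar \<gamma> \<kappa> vref Uh Uc"
    using s_of_pos[OF assms(3) \<rho>1z1, of \<gamma> \<kappa>] by (meson ereal_less_eq(3) less_imp_le order_trans)
  from alpha_max_less[OF assms(7) h(1) c(1) this]
  have \<alpha>: "alpha_std \<gamma> \<kappa> vref Uh Uc < \<alpha>" "\<bar>vh\<bar> < \<alpha>" "\<bar>vc\<bar> < \<alpha>"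
    unfolding vh_def vc_def by simp_all
  then have \<alpha>pos: "\<alpha> > 0" by linarith
  have ab: "a > 0" "b > 0" "2 * \<alpha> * a = \<alpha> + vh" "a + b - 1 = (vh - vc) / (2 * \<alpha>)"
    using \<alpha> \<alpha>pos unfolding a_def b_def by (auto simp: field_simps)
  have Upos: "U $ 1 > 0" "U $ 3 > 0"
    using ab h c by (simp_all add: U add_pos_pos)

  define s where "s = s_of \<gamma> \<kappa> vref (U $ 1) (U $ 3)"
  have s: "s > 0" unfolding s_def using assms(3) Upos by (rule s_of_pos)
  have "U $ 1 = rho1 Uh Uc + (Uh $ 1 * vh - Uc $ 1 * vc) / (2 * \<alpha>)"
    "U $ 3 = z1 Uh Uc + (Uh $ 3 * vh - Uc $ 3 * vc) / (2 * \<alpha>)"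
    using \<alpha>pos unfolding U a_def b_def rho1_def z1_def by (simp_all add: field_simps)
  then have "(U $ 1, U $ 3) \<in> rect \<gamma> \<kappa> vref Uh Uc"
    using add_divide_in_rect[OF assms(6)] \<alpha>(1) unfolding vh_def vc_def by simp
  then have "ereal s \<le> s_bar \<gamma> \<kappa> vref Uh Uc"
    unfolding s_def using Upos by (rule s_of_le_s_bar)
  from alpha_max_less(2)[OF assms(7) h(1) c(1) this]
  have "\<bar>vh\<bar> + s / Uh $ 1 < \<alpha>" unfolding vh_def .
  \<comment> \<open>Uses \<alpha> + vh \<ge> \<alpha> - |vh|.\<close>
  then have "s / Uh $ 1 \<le> 2 * \<alpha> * a" using ab(3) by linarith
  then have key: "s / (2 * \<alpha>) \<le> a * Uh $ 1"
    using h(1) \<alpha>pos by (simp add: field_simps)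

  have y: "V $ 2 = V $ 1 * (v_of \<gamma> \<kappa> vref V + ?p (V $ 1) (V $ 3))" if "V $ 1 > 0" for V :: "real^3"
    using that unfolding v_of_def w_of_def by simp
  have "U $ 1 * (?p (U $ 1) (U $ 3) - ?p (U $ 1 / (a + b)) (U $ 3 / (a + b))) \<le> s * (a + b - 1)"
    unfolding s_def using assms(1,3) Upos ab by (intro rho_press_scaling) auto
  moreover have "U $ 1 * ?p (U $ 1 / (a + b)) (U $ 3 / (a + b))
      \<le> a * (Uh $ 1 * ?p (Uh $ 1) (Uh $ 3)) + b * (Uc $ 1 * ?p (Uc $ 1) (Uc $ 3))"
    using assms(1-3) h(1,2) c(1,2) ab(1,2) U U by (rule rho_press_jensen)
  ultimately have pU: "U $ 1 * ?p (U $ 1) (U $ 3) \<le> a * (Uh $ 1 * ?p (Uh $ 1) (Uh $ 3))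
      + b * (Uc $ 1 * ?p (Uc $ 1) (Uc $ 3)) + s * (a + b - 1)"
    by (simp add: algebra_simps)
  have "U $ 1 * v_of \<gamma> \<kappa> vref U = U $ 2 - U $ 1 * ?p (U $ 1) (U $ 3)"
    using y[OF Upos(1)] by (simp add: algebra_simps)
  moreover have "U $ 2 = a * (Uh $ 1 * vh) + b * (Uc $ 1 * vc)
      + (a * (Uh $ 1 * ?p (Uh $ 1) (Uh $ 3)) + b * (Uc $ 1 * ?p (Uc $ 1) (Uc $ 3)))"
    unfolding U[of 2] y[OF h(1)] y[OF c(1)] vh_def vc_def by (simp add: algebra_simps)
  moreover have "s * (a + b - 1) = s / (2 * \<alpha>) * (vh - vc)"
    unfolding ab(4) by simp
  ultimately have "a * (Uh $ 1 * vh) + b * (Uc $ 1 * vc) - s / (2 * \<alpha>) * (vh - vc)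
      \<le> U $ 1 * v_of \<gamma> \<kappa> vref U"
    using pU by linarith
  moreover have "0 \<le> (a * Uh $ 1 - s / (2 * \<alpha>)) * (vh - vmin)"
    using key h(5) by simp
  moreover have "0 \<le> (b * Uc $ 1 + s / (2 * \<alpha>)) * (vc - vmin)"
    using ab c s \<alpha>pos by simp
  \<comment> \<open>The s terms cancel in the sum of the two coefficients, leaving
    \<open>U $ 1\<close> as the factor of \<open>vmin\<close>.\<close>
  moreover have "(a * Uh $ 1 - s / (2 * \<alpha>)) * (vh - vmin) + (b * Uc $ 1 + s / (2 * \<alpha>)) * (vc - vmin)
      = a * (Uh $ 1 * vh) + b * (Uc $ 1 * vc) - s / (2 * \<alpha>) * (vh - vc) - U $ 1 * vmin"
    unfolding U[of 1] by (simp add: algebra_simps add_divide_distrib[symmetric])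
  ultimately have "U $ 1 * vmin \<le> U $ 1 * v_of \<gamma> \<kappa> vref U" by linarith
  then have "vmin \<le> v_of \<gamma> \<kappa> vref U" using Upos(1) by simp
  moreover have "w_of U \<in> {wmin..wmax}" "c_of U \<in> {cmin..cmax}"
    using h(3,4) c(3,4) mediant_in_interval[OF ab(1,2) h(1) c(1)]
    unfolding w_of_def c_of_def U by blast+
  ultimately show ?thesis
    using Upos unfolding U_def[symmetric] Omega_def by simp
qed

end
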